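(* Let $d\ge 2$ and let $(\mathcal{D}_n)_{n\in\mathbb{N}}$ be a sequence of finite, non-empty subsets of $\mathbb{N}^d$ such that: (1) for every fixed $c\in\mathbb{Z}^d$, $\displaystyle\lim_{n\to\infty}\frac{\#((\mathcal{D}_n+c)\cap \mathcal{D}_n)}{\#\mathcal{D}_n}=1$; (2) there exists $K>0$ such that for all $i,j\in\{1,\ldots,d\}$ with $i\ne j$, all $a,b\in\mathbb{N}$ and all $n\in\mathbb{N}$, $\displaystyle\frac{\#(\mathcal{D}_n\cap \mathbb{Z}_i(a)\cap \mathbb{Z}_j(b))}{\#\mathcal{D}_n}\le\frac{K}{ab}$. For each $n\in\mathbb{N}$, let $(X_1^{(n)},\ldots,X_d^{(n)})$ be a random vector with the uniform distribution on $\mathcal{D}_n$. Then, as $n\to\infty$, in distribution, $$\frac{\operatorname{lcm}(X_1^{(n)},\ldots,X_d^{(n)})}{X_1^{(n)}\cdots X_d^{(n)}}\ \longrightarrow\ \prod_{p\in\mathcal{P}}p^{\max_{k=1,\ldots,d}\mathcal{G}_k(p)-\sum_{k=1}^{d}\mathcal{G}_k(p)}.$$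
   Context: $\mathbb{N}=\{1,2,3,\ldots\}$, $\mathbb{N}_0=\mathbb{N}\cup\{0\}$, $\mathcal{P}$ is the set of primes, $\#$ denotes cardinality. For $i=1,\ldots,d$ and $a\in\mathbb{N}$, $\mathbb{Z}_i(a):=\{(x_1,\ldots,x_d)\in\mathbb{Z}^d: x_i\text{ is divisible by }a\}$. $(\mathcal{G}_1(p),\ldots,\mathcal{G}_d(p))_{p\in\mathcal{P}}$ is an array of mutually independent random variables with $\mathbb{P}\{\mathcal{G}_k(p)\ge j\}=p^{-j}$ for $j\in\mathbb{N}_0$, $p\in\mathcal{P}$, $k=1,\ldots,d$. *)

theory Defs
  imports "HOL-Probability.Probability" "HOL-Computational_Algebra.Primes"
begin

text \<open>
  Points of \<open>\<int>\<^sup>d\<close> are vectors of type \<open>int ^ 'd\<close>, with \<open>d = CARD('d)\<close>; points of \<open>\<nat>\<^sup>d\<close> are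
  those whose coordinates are all positive.
\<close>

definition pos_vecs :: "(int ^ 'd) set" where
  "pos_vecs = {x. \<forall>i. x $ i \<ge> 1}"

definition coord_multiples :: "'d \<Rightarrow> nat \<Rightarrow> (int ^ 'd) set" where
  "coord_multiples i a = {x. int a dvd x $ i}"

definition lcm_prod_ratio :: "int ^ 'd \<Rightarrow> real" where
  "lcm_prod_ratio x = real_of_int (LCM i\<in>UNIV. x $ i) / real_of_int (\<Prod>i\<in>UNIV. x $ i)"

text \<open>
  The product over primes is written as a product over all natural numbers, with factor 1 at the
  non-primes. In the intended use the product converges for almost every \<open>\<omega>\<close> (by Borel--Cantelli,
  almost surely only finitely many factors differ from 1); where it does not converge,
  \<^const>\<open>prodinf\<close> is an unspecified constant, which does not affect the distribution.
\<close>

definition lcm_limit :: "('d::finite \<Rightarrow> nat \<Rightarrow> 'a \<Rightarrow> nat) \<Rightarrow> 'a \<Rightarrow> real" where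
  "lcm_limit G \<omega> = prodinf (\<lambda>p. if prime p
     then real p powi (int (MAX k. G k p \<omega>) - int (\<Sum>k\<in>UNIV. G k p \<omega>)) else 1)"

end

theory Submission
  imports Defs "HOL-Real_Asymp.Real_Asymp"
begin

text \<open>
  Both sides are the same function of an array of prime valuations. For a vector \<open>x\<close> of positive
  integers, let \<open>v\<^sub>p(x\<^sub>k)\<close> be the exponent of \<open>p\<close> in \<open>x\<^sub>k\<close>. Then \<open>lcm(x) / \<Prod> x\<^sub>k\<close> is the product over
  all primes of \<open>p\<close> to the power \<open>max\<^sub>k v\<^sub>p(x\<^sub>k) - \<Sum>\<^sub>k v\<^sub>p(x\<^sub>k)\<close>
  (\<open>lcm_prod_ratio_eq_lcm_limit\<close>), and the limit variable is the same product with the independent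
  geometric exponents in place of \<open>v\<^sub>p(x\<^sub>k)\<close>. So it is enough to compare the laws of two arrays of
  exponents, and two facts about them suffice.

  First, the joint law on finitely many primes converges. By the near-invariance of \<open>D\<^sub>n\<close> under
  translations, all residue classes modulo given \<open>a\<^sub>1, \<dots>, a\<^sub>d\<close> get asymptotically the same mass, so the
  probability that every \<open>a\<^sub>k\<close> divides \<open>X\<^sub>k\<close> tends to \<open>1 / \<Prod> a\<^sub>k\<close> (\<open>residue_equidistribution\<close>).
  With prime power products for \<open>a\<^sub>k\<close> the limits are the joint tails of the independent
  geometric exponents, and inclusion--exclusion turns joint tails into point probabilities
  (\<open>point_probabilities_from_tails\<close>).

  Second, the product depends, up to small probability uniformly in \<open>n\<close>, on finitely many values of
  the exponents at finitely many primes. The factor at \<open>p\<close> is \<open>1\<close> unless \<open>p\<close> divides two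
  coordinates; by the second hypothesis this has probability \<open>O(p\<^sup>-\<^sup>2)\<close>, which is summable. Likewise it
  is unlikely that an exponent at a prime \<open>p \<le> m\<close> exceeds \<open>m\<close>. This is \<open>prob_exceptional_le\<close>, stated
  for a locale of arrays whose pair tails are bounded by \<open>K / (p\<^sup>a p\<^sup>b)\<close>; the valuations of \<open>X\<close> and the
  geometric exponents are both instances.

  Together they give more than convergence in distribution: for every Borel set \<open>A\<close>, the
  probability that the ratio lies in \<open>A\<close> converges (\<open>lcm_limit_laws_converge\<close>).
\<close>

section \<open>The ratio as a product over primes\<close>

definition coord_valuation :: "'d \<Rightarrow> nat \<Rightarrow> int ^ 'd \<Rightarrow> nat" where
  "coord_valuation k p x = multiplicity p (nat (x $ k))"

definition prime_factor_term :: "nat \<Rightarrow> ('d::finite \<Rightarrow> nat) \<Rightarrow> real" where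
  "prime_factor_term p v = real p powi (int (MAX k. v k) - int (\<Sum>k\<in>UNIV. v k))"

lemma lcm_limit_eq:
  "lcm_limit W \<omega> = prodinf (\<lambda>p. if prime p then prime_factor_term p (\<lambda>k. W k p \<omega>) else 1)"
  unfolding lcm_limit_def prime_factor_term_def ..

text \<open>
  The lcm and the product of numbers differ at \<open>p\<close> only if \<open>p\<close> divides two of the numbers; hence large
  primes rarely contribute to the ratio.
\<close>

lemma sum_eq_of_at_most_one_nonzero:
  fixes v :: "'d::finite \<Rightarrow> nat"
  assumes "\<And>i j. i \<noteq> j \<Longrightarrow> v i = 0 \<or> v j = 0"
  shows "(\<Sum>k\<in>UNIV. v k) = (MAX k. v k)"
proof (cases "\<exists>i. v i \<noteq> 0")
  case True
  then obtain i where i: "v i \<noteq> 0" by blast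
  have z: "v k = 0" if "k \<noteq> i" for k using assms[OF that] i by simp
  have "(\<Sum>k\<in>UNIV. v k) = (\<Sum>k\<in>UNIV. if k = i then v i else 0)"
    by (intro sum.cong) (auto simp: z)
  also have "\<dots> = v i" by simp
  also have "v i = (MAX k. v k)"
  proof (rule Max_eqI [symmetric])
    fix y assume "y \<in> range v"
    then obtain k where "y = v k" by blast
    then show "y \<le> v i" by (cases "k = i") (simp_all add: z)
  qed auto
  finally show ?thesis .
next
  case False
  then have "v = (\<lambda>_. 0)" by auto
  then show ?thesis by (simp add: image_constant_conv)
qed

lemma prime_factor_term_eq_1:
  assumes "\<And>i j. i \<noteq> j \<Longrightarrow> v i = 0 \<or> v j = 0"
  shows "prime_factor_term p v = 1"
  unfolding prime_factor_term_def by (subst sum_eq_of_at_most_one_nonzero) (use assms in auto)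

lemma MAX_le_sum:
  fixes v :: "'d::finite \<Rightarrow> nat"
  shows "(MAX k. v k) \<le> (\<Sum>k\<in>UNIV. v k)"
  by (auto intro: member_le_sum)

lemma prime_factor_term_bounds:
  assumes "prime p"
  shows "0 < prime_factor_term p v" "prime_factor_term p v \<le> 1"
proof -
  from assms have p: "real p \<ge> 1" using prime_ge_1_nat[of p] by linarith
  then show "0 < prime_factor_term p v"
    by (simp add: prime_factor_term_def zero_less_power_int)
  have "int (MAX k. v k) - int (\<Sum>k\<in>UNIV. v k) \<le> 0"
    using MAX_le_sum[of v] by linarith
  then have "real p powi (int (MAX k. v k) - int (\<Sum>k\<in>UNIV. v k)) \<le> real p powi 0"
    by (intro power_int_increasing p) 
  then show "prime_factor_term p v \<le> 1"
    by (simp add: prime_factor_term_def)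
qed

text \<open>
  All infinite products below are evaluated through this lemma, so questions of convergence arise
  only for measurability.
\<close>

lemma lcm_limit_eq_finite_prod:
  assumes "finite S" "\<And>p. p \<in> S \<Longrightarrow> prime p"
    and "\<And>p i j. prime p \<Longrightarrow> p \<notin> S \<Longrightarrow> i \<noteq> j \<Longrightarrow> W i p \<omega> = 0 \<or> W j p \<omega> = 0"
  shows "lcm_limit W \<omega> = (\<Prod>p\<in>S. prime_factor_term p (\<lambda>k. W k p \<omega>))"
proof -
  have "lcm_limit W \<omega> = (\<Prod>p\<in>S. if prime p then prime_factor_term p (\<lambda>k. W k p \<omega>) else 1)"
    unfolding lcm_limit_eq
    by (intro prodinf_finite assms) (auto intro!: prime_factor_term_eq_1 simp del: neq0_conv dest: assms(3))
  also have "\<dots> = (\<Prod>p\<in>S. prime_factor_term p (\<lambda>k. W k p \<omega>))"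
    by (intro prod.cong) (use assms in auto)
  finally show ?thesis .
qed

lemma prod_prime_powers_dvd_iff:
  fixes y :: nat
  assumes "finite T" "\<And>p. p \<in> T \<Longrightarrow> prime p" "y \<noteq> 0"
  shows "(\<Prod>p\<in>T. p ^ j p) dvd y \<longleftrightarrow> (\<forall>p\<in>T. j p \<le> multiplicity p y)"
proof
  assume dvd: "(\<Prod>p\<in>T. p ^ j p) dvd y"
  show "\<forall>p\<in>T. j p \<le> multiplicity p y"
  proof
    fix p assume p: "p \<in> T"
    have "p ^ j p dvd (\<Prod>p\<in>T. p ^ j p)"
      by (rule dvd_prodI) (use assms p in auto)
    with dvd have "p ^ j p dvd y" using dvd_trans by blast
    moreover from assms p have "prime p" by blast
    ultimately show "j p \<le> multiplicity p y"
      using assms by (intro multiplicity_geI) (auto dest: not_prime_unit)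
  qed
next
  assume *: "\<forall>p\<in>T. j p \<le> multiplicity p y"
  show "(\<Prod>p\<in>T. p ^ j p) dvd y"
  proof (rule multiplicity_le_imp_dvd)
    show "(\<Prod>p\<in>T. p ^ j p) \<noteq> 0" using assms(1,2) by (force simp: prime_gt_0_nat)
    fix q :: nat assume "prime q"
    then show "multiplicity q (\<Prod>p\<in>T. p ^ j p) \<le> multiplicity q y"
      using assms * by (subst multiplicity_prod_prime_powers) auto
  qed
qed

lemma prod_prime_powers_superset:
  fixes y :: nat
  assumes "finite S" "prime_factors y \<subseteq> S" "\<And>p. p \<in> S \<Longrightarrow> prime p" "y \<noteq> 0"
  shows "(\<Prod>p\<in>S. p ^ multiplicity p y) = y"
proof -
  have "(\<Prod>p\<in>S. p ^ multiplicity p y) = (\<Prod>p\<in>prime_factors y. p ^ multiplicity p y)"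
    using assms
    by (intro prod.mono_neutral_right) (auto simp: prime_factors_multiplicity)
  with prod_prime_factors[of y] assms show ?thesis by simp
qed

text \<open>
  Only primes dividing some coordinate matter. Over these, each coordinate and the lcm are products of
  prime powers, and the exponent in the lcm is the largest exponent among the coordinates.
\<close>

lemma lcm_prod_ratio_eq_lcm_limit:
  fixes x :: "int ^ 'd::finite"
  assumes "x \<in> pos_vecs"
  shows "lcm_prod_ratio x = lcm_limit coord_valuation x"
proof -
  define y where "y k = nat (x $ k)" for k
  define V where "V k p = multiplicity p (y k)" for k p
  define S where "S = (\<Union>k. prime_factors (y k))"
  define m where "m p = (MAX k. V k p)" for p
  have xy: "x $ k = int (y k)" "y k \<noteq> 0" for k
  proof -
    have "x $ k \<ge> 1" using assms by (simp add: pos_vecs_def)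
    then show "x $ k = int (y k)" "y k \<noteq> 0" by (simp_all add: y_def)
  qed
  have S: "finite S" "\<And>p. p \<in> S \<Longrightarrow> prime p"
    by (auto simp: S_def)
  have V0: "V k p = 0" if "prime p" "p \<notin> S" for k p
    using that by (auto simp: S_def V_def prime_factors_multiplicity)
  have y_eq: "(\<Prod>p\<in>S. p ^ V k p) = y k" for k
    unfolding V_def by (intro prod_prime_powers_superset) (use S xy in \<open>auto simp: S_def\<close>)
  have lcm_eq: "(LCM i\<in>UNIV. x $ i) = int (\<Prod>p\<in>S. p ^ m p)"
  proof (rule Lcm_eqI)
    fix a assume "a \<in> range (($) x)"
    then obtain k where "a = int (y k)" by (auto simp: xy)
    moreover have "(\<Prod>p\<in>S. p ^ V k p) dvd (\<Prod>p\<in>S. p ^ m p)"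
      by (intro prod_dvd_prod le_imp_power_dvd) (auto simp: m_def)
    ultimately show "a dvd int (\<Prod>p\<in>S. p ^ m p)"
      by (simp add: y_eq del: of_nat_prod)
  next
    fix c :: int assume c: "\<And>a. a \<in> range (($) x) \<Longrightarrow> a dvd c"
    show "int (\<Prod>p\<in>S. p ^ m p) dvd c"
    proof (cases "c = 0")
      case False
      have dvd: "y k dvd nat \<bar>c\<bar>" for k
        using c[of "x $ k"] by (simp add: xy nat_abs_dvd_iff)
      have "m p \<le> multiplicity p (nat \<bar>c\<bar>)" for p
      proof -
        have "m p \<in> range (\<lambda>k. V k p)" unfolding m_def by (intro Max_in) auto
        then obtain k where "m p = V k p" by blast
        with dvd[of k] False show ?thesis 
          by (simp add: V_def dvd_imp_multiplicity_le)
      qed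
      then have "(\<Prod>p\<in>S. p ^ m p) dvd nat \<bar>c\<bar>"
        using S False by (subst prod_prime_powers_dvd_iff) auto
      then show ?thesis by (simp del: of_nat_prod)
    qed auto
  qed (simp add: abs_prod)
  have "lcm_prod_ratio x = (\<Prod>p\<in>S. real p ^ m p) / (\<Prod>k\<in>UNIV. \<Prod>p\<in>S. real p ^ V k p)"
    unfolding lcm_prod_ratio_def lcm_eq
    by (simp add: xy y_eq [symmetric])
  also have "(\<Prod>k\<in>UNIV. \<Prod>p\<in>S. real p ^ V k p) = (\<Prod>p\<in>S. real p ^ (\<Sum>k\<in>UNIV. V k p))"
    by (subst prod.swap) (simp add: power_sum)
  also have "(\<Prod>p\<in>S. real p ^ m p) / \<dots> = (\<Prod>p\<in>S. prime_factor_term p (\<lambda>k. V k p))"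
    unfolding prod_dividef [symmetric]
  proof (intro prod.cong refl)
    fix p assume "p \<in> S"
    then have "real p \<noteq> 0" using S(2)[of p] by (auto dest: prime_gt_0_nat)
    then show "real p ^ m p / real p ^ (\<Sum>k\<in>UNIV. V k p) = prime_factor_term p (\<lambda>k. V k p)"
      unfolding prime_factor_term_def m_def
      by (subst power_int_diff) (auto simp del: of_nat_sum)
  qed
  also have "\<dots> = lcm_limit coord_valuation x"
    using S V0 unfolding V_def y_def coord_valuation_def [symmetric]
    by (intro lcm_limit_eq_finite_prod [symmetric]) auto
  finally show ?thesis .
qed

section \<open>Equidistribution in residue classes\<close>

text \<open>
  Translating by \<open>r\<close> matches the points of \<open>D \<inter> B\<close> with points of \<open>B + r\<close>; those that are lost lie in
  \<open>(D + r) - D\<close>, those that are missed lie in \<open>D - (D + r)\<close>, and both sets have as many elements as \<open>D\<close>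
  has points outside the overlap of \<open>D\<close> and \<open>D + r\<close>.
\<close>

lemma card_Int_translate_diff_le:
  fixes D :: "'a::ab_group_add set"
  assumes "finite D"
  shows "\<bar>real (card (D \<inter> B)) - real (card (D \<inter> (\<lambda>x. x + r) ` B))\<bar>
    \<le> real (card D) - real (card ((\<lambda>x. x + r) ` D \<inter> D))"
proof -
  define t where "t = (\<lambda>x::'a. x + r)"
  have inj: "inj_on t A" for A by (auto simp: t_def inj_on_def)
  have c: "card (t ` A) = card A" for A by (intro card_image inj)
  define E where "E = t ` D \<inter> D"
  have fin: "finite E" "finite (t ` D)" using assms by (auto simp: E_def)
  have img: "t ` (D \<inter> B) = t ` D \<inter> t ` B"
    using inj[of UNIV] by (simp add: image_Int)
  have le: "card E \<le> card D" using assms by (auto simp: E_def intro: card_mono)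
  have "card (D \<inter> B) = card (t ` D \<inter> t ` B)" using c img by metis
  also have "\<dots> \<le> card ((E \<inter> t ` B) \<union> (t ` D - E))"
    using fin by (intro card_mono) (auto simp: E_def)
  also have "\<dots> \<le> card (E \<inter> t ` B) + card (t ` D - E)" by (rule card_Un_le)
  also have "card (t ` D - E) = card D - card E"
    using fin by (subst card_Diff_subset) (auto simp: c E_def)
  finally have 1: "card (D \<inter> B) \<le> card (E \<inter> t ` B) + (card D - card E)" .
  have "card (D \<inter> t ` B) \<le> card ((E \<inter> t ` B) \<union> (D - E))"
    using fin assms by (intro card_mono) (auto simp: E_def)
  also have "\<dots> \<le> card (E \<inter> t ` B) + card (D - E)" by (rule card_Un_le)
  also have "card (D - E) = card D - card E"
    using fin by (subst card_Diff_subset) (auto simp: c E_def)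
  finally have 2: "card (D \<inter> t ` B) \<le> card (E \<inter> t ` B) + (card D - card E)" .
  have 3: "card (E \<inter> t ` B) \<le> card (D \<inter> t ` B)"
    using assms by (intro card_mono) (auto simp: E_def)
  have "card (E \<inter> t ` B) \<le> card (t ` (D \<inter> B))"
    unfolding img using fin by (intro card_mono) (auto simp: E_def)
  then have 4: "card (E \<inter> t ` B) \<le> card (D \<inter> B)" using c by simp
  show ?thesis
    using 1 2 3 4 le unfolding t_def [symmetric] E_def [symmetric] by linarith
qed

lemma card_vec_box:
  fixes a :: "'d::finite \<Rightarrow> nat"
  shows "card {r :: int ^ 'd. \<forall>k. 0 \<le> r $ k \<and> r $ k < int (a k)} = (\<Prod>k\<in>UNIV. a k)"
    and "finite {r :: int ^ 'd. \<forall>k. 0 \<le> r $ k \<and> r $ k < int (a k)}"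
proof -
  have eq: "{r :: int ^ 'd. \<forall>k. 0 \<le> r $ k \<and> r $ k < int (a k)}
      = vec_lambda ` (PiE UNIV (\<lambda>k. {0..<int (a k)}))" (is "?S = _ ` ?P")
  proof (intro equalityI subsetI)
    fix r assume "r \<in> ?S"
    then show "r \<in> vec_lambda ` ?P"
      by (intro image_eqI[of _ _ "vec_nth r"]) (auto simp: vec_nth_inverse)
  qed auto
  have "card ?S = card ?P"
    unfolding eq by (intro card_image inj_onI) (metis vec_lambda_inverse UNIV_I)
  then show "card ?S = (\<Prod>k\<in>UNIV. a k)" by (simp add: card_PiE)
  show "finite ?S" unfolding eq by (intro finite_imageI finite_PiE) auto
qed

text \<open>
  The residue classes modulo \<open>a\<^sub>1, \<dots>, a\<^sub>d\<close> are translates of the lattice of vectors with \<open>a\<^sub>k | x\<^sub>k\<close>, so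
  their relative masses in \<open>D\<^sub>n\<close> become equal. There are \<open>\<Prod> a\<^sub>k\<close> of them and the masses sum to \<open>1\<close>.
\<close>

lemma residue_equidistribution:
  fixes D :: "nat \<Rightarrow> (int ^ 'd::finite) set" and a :: "'d \<Rightarrow> nat"
  assumes D: "\<And>n. finite (D n)" "\<And>n. D n \<noteq> {}"
    and shift: "\<And>c :: int ^ 'd.
      (\<lambda>n. real (card ((\<lambda>x. x + c) ` D n \<inter> D n)) / real (card (D n))) \<longlonglongrightarrow> 1"
    and a: "\<And>k. a k > 0"
  shows "(\<lambda>n. real (card (D n \<inter> {x. \<forall>k. int (a k) dvd x $ k})) / real (card (D n)))
    \<longlonglongrightarrow> 1 / (\<Prod>k\<in>UNIV. real (a k))"
proof -
  define L where "L = {x :: int ^ 'd. \<forall>k. int (a k) dvd x $ k}"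
  define S where "S = {r :: int ^ 'd. \<forall>k. 0 \<le> r $ k \<and> r $ k < int (a k)}"
  define C where "C r = (\<lambda>x. x + r) ` L" for r
  define q where "q n r = real (card (D n \<inter> C r)) / real (card (D n))" for n r
  define q0 where "q0 n = real (card (D n \<inter> L)) / real (card (D n))" for n
  have S: "finite S" "card S = (\<Prod>k\<in>UNIV. a k)"
    unfolding S_def by (rule card_vec_box)+
  have pos: "card (D n) > 0" for n using D by (simp add: card_gt_0_iff)
  have C_iff: "x \<in> C r \<longleftrightarrow> (\<forall>k. int (a k) dvd x $ k - r $ k)" for x r
  proof
    assume "\<forall>k. int (a k) dvd x $ k - r $ k"
    then show "x \<in> C r" unfolding C_def by (intro image_eqI[of _ _ "x - r"]) (auto simp: L_def)
  qed (auto simp: C_def L_def)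
  have disj: "C r \<inter> C s = {}" if "r \<in> S" "s \<in> S" "r \<noteq> s" for r s
  proof (rule ccontr)
    assume "C r \<inter> C s \<noteq> {}"
    then obtain x where x: "x \<in> C r" "x \<in> C s" by blast
    have "r $ k = s $ k" for k
    proof -
      from x have "x $ k mod int (a k) = r $ k mod int (a k)"
        "x $ k mod int (a k) = s $ k mod int (a k)"
        by (auto simp: C_iff mod_eq_dvd_iff)
      moreover have "r $ k mod int (a k) = r $ k" "s $ k mod int (a k) = s $ k"
        using that by (auto simp: S_def)
      ultimately show ?thesis by simp
    qed
    with \<open>r \<noteq> s\<close> show False by (simp add: vec_eq_iff)
  qed
  have cover: "(\<Union>r\<in>S. C r) = UNIV"
  proof -
    have "x \<in> C (\<chi> k. x $ k mod int (a k))" for x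
      by (auto simp: C_iff)
    moreover have "(\<chi> k. x $ k mod int (a k)) \<in> S" for x :: "int ^ 'd"
      using a by (auto simp: S_def)
    ultimately show ?thesis by blast
  qed
  have sum1: "(\<Sum>r\<in>S. q n r) = 1" for n
  proof -
    have "card (D n) = card (\<Union>r\<in>S. D n \<inter> C r)"
      using cover by (simp flip: Int_UN_distrib)
    also have "\<dots> = (\<Sum>r\<in>S. card (D n \<inter> C r))"
      using S D disj by (intro card_UN_disjoint) blast+
    finally show ?thesis using pos[of n]
      by (simp add: q_def flip: sum_divide_distrib of_nat_sum)
  qed
  have lim: "(\<lambda>n. q0 n - q n r) \<longlonglongrightarrow> 0" for r
  proof (rule Lim_null_comparison)
    show "(\<lambda>n. 1 - real (card ((\<lambda>x. x + r) ` D n \<inter> D n)) / real (card (D n))) \<longlonglongrightarrow> 0"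
      using tendsto_diff[OF tendsto_const[of 1] shift[of r]] by simp
    have "norm (q0 n - q n r)
        \<le> 1 - real (card ((\<lambda>x. x + r) ` D n \<inter> D n)) / real (card (D n))" for n
    proof -
      have "norm (q0 n - q n r) = 
          \<bar>real (card (D n \<inter> L)) - real (card (D n \<inter> C r))\<bar> / real (card (D n))"
        by (simp add: q0_def q_def flip: diff_divide_distrib)
      also have "\<dots> \<le> (real (card (D n)) - real (card ((\<lambda>x. x + r) ` D n \<inter> D n))) / real (card (D n))"
        unfolding C_def by (intro divide_right_mono card_Int_translate_diff_le D) auto
      also have "\<dots> = 1 - real (card ((\<lambda>x. x + r) ` D n \<inter> D n)) / real (card (D n))"
        using pos[of n] by (simp add: diff_divide_distrib)
      finally show ?thesis .
    qed
    then show "\<forall>\<^sub>F n in sequentially. norm (q0 n - q n r)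
        \<le> 1 - real (card ((\<lambda>x. x + r) ` D n \<inter> D n)) / real (card (D n))"
      by simp
  qed
  \<comment> \<open>The mass of the lattice is \<open>1 / card S\<close> plus the average of its differences to the masses of the
    classes.\<close>
  have cS: "real (card S) > 0" using S a by (simp add: prod_pos)
  have "(\<lambda>n. (1 + (\<Sum>r\<in>S. q0 n - q n r)) / real (card S)) \<longlonglongrightarrow> (1 + (\<Sum>r\<in>S. 0)) / real (card S)"
    using cS by (intro tendsto_intros lim) auto
  moreover have "(1 + (\<Sum>r\<in>S. q0 n - q n r)) / real (card S) = q0 n" for n
    using cS by (simp add: sum_subtractf sum1)
  ultimately show ?thesis by (simp add: q0_def L_def S)
qed

section \<open>From joint tails to joint point probabilities\<close>

text \<open>
  One step of inclusion--exclusion: \<open>Y\<^sub>x = j\<^sub>x\<close> means \<open>Y\<^sub>x \<ge> j\<^sub>x\<close> but not \<open>Y\<^sub>x \<ge> j\<^sub>x + 1\<close>. The conditions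
  \<open>Y\<^sub>i \<ge> j\<^sub>i\<close> are kept for all \<open>i \<in> S\<close>, so that both terms on the right have the same shape with the
  smaller set \<open>J\<close>.
\<close>

lemma (in finite_measure) measure_pin_coordinate:
  fixes Y :: "'i \<Rightarrow> 'a \<Rightarrow> nat"
  assumes [measurable]: "\<And>i. i \<in> S \<Longrightarrow> Y i \<in> M \<rightarrow>\<^sub>M count_space UNIV"
    and S: "finite S" "x \<in> S" "J \<subseteq> S" "x \<notin> J"
  shows "measure M {\<omega> \<in> space M. (\<forall>i\<in>S. j i \<le> Y i \<omega>) \<and> (\<forall>i\<in>insert x J. Y i \<omega> = j i)}
    = measure M {\<omega> \<in> space M. (\<forall>i\<in>S. j i \<le> Y i \<omega>) \<and> (\<forall>i\<in>J. Y i \<omega> = j i)}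
    - measure M {\<omega> \<in> space M. (\<forall>i\<in>S. (j(x := Suc (j x))) i \<le> Y i \<omega>)
        \<and> (\<forall>i\<in>J. Y i \<omega> = (j(x := Suc (j x))) i)}"
    (is "measure M ?A = measure M ?B - measure M ?C")
proof -
  have fJ: "finite J" using S finite_subset by blast
  have [measurable]: "Y i \<in> M \<rightarrow>\<^sub>M count_space UNIV" if "i \<in> J" for i
    using that S by (intro assms(1)) auto
  have C_iff: "\<omega> \<in> ?C \<longleftrightarrow> \<omega> \<in> ?B \<and> j x < Y x \<omega>" for \<omega>
  proof
    assume "\<omega> \<in> ?C"
    then have *: "\<omega> \<in> space M" "\<And>i. i \<in> S \<Longrightarrow> (j(x := Suc (j x))) i \<le> Y i \<omega>"
      "\<And>i. i \<in> J \<Longrightarrow> Y i \<omega> = (j(x := Suc (j x))) i" by blast+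
    have "j i \<le> Y i \<omega>" if "i \<in> S" for i
      using *(2)[OF that] by (auto split: if_splits)
    moreover have "Y i \<omega> = j i" if "i \<in> J" for i
      using *(3)[OF that] that S(4) by (auto split: if_splits)
    moreover have "j x < Y x \<omega>" using *(2)[OF S(2)] by simp
    ultimately show "\<omega> \<in> ?B \<and> j x < Y x \<omega>" using *(1) by blast
  next
    assume "\<omega> \<in> ?B \<and> j x < Y x \<omega>"
    then show "\<omega> \<in> ?C" using S(4) by auto
  qed
  have "?C \<subseteq> ?B" using C_iff by blast
  moreover have "?A = ?B - ?C"
  proof (intro equalityI subsetI)
    fix \<omega> assume w: "\<omega> \<in> ?A"
    then have "\<omega> \<in> ?B" "Y x \<omega> = j x" by blast+
    then show "\<omega> \<in> ?B - ?C" using C_iff[of \<omega>] by simp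
  next
    fix \<omega> assume w: "\<omega> \<in> ?B - ?C"
    then have "\<not> j x < Y x \<omega>" using C_iff[of \<omega>] by blast
    moreover have "j x \<le> Y x \<omega>" using w S(2) by blast
    ultimately have "Y x \<omega> = j x" by simp
    with w show "\<omega> \<in> ?A" by blast
  qed
  moreover have "?B \<in> sets M" "?C \<in> sets M"
    using S fJ by measurable
  ultimately show ?thesis
    by (simp add: finite_measure_Diff)
qed

text \<open>
  Induction on the set of coordinates whose value is prescribed exactly, with the thresholds \<open>j\<close>
  arbitrary: each coordinate is pinned by a difference of two sequences whose convergence is known.
\<close>

lemma point_probabilities_from_tails:
  fixes Y :: "nat \<Rightarrow> 'i \<Rightarrow> 'a \<Rightarrow> nat" and Y' :: "'i \<Rightarrow> 'b \<Rightarrow> nat"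
  assumes "finite S"
    and "\<And>n. finite_measure (M n)" "finite_measure N"
    and Y: "\<And>n i. i \<in> S \<Longrightarrow> Y n i \<in> M n \<rightarrow>\<^sub>M count_space UNIV"
    and Y': "\<And>i. i \<in> S \<Longrightarrow> Y' i \<in> N \<rightarrow>\<^sub>M count_space UNIV"
    and tails: "\<And>j. (\<lambda>n. measure (M n) {\<omega> \<in> space (M n). \<forall>i\<in>S. j i \<le> Y n i \<omega>})
      \<longlonglongrightarrow> measure N {\<omega> \<in> space N. \<forall>i\<in>S. j i \<le> Y' i \<omega>}"
  shows "(\<lambda>n. measure (M n) {\<omega> \<in> space (M n). \<forall>i\<in>S. Y n i \<omega> = j i})
    \<longlonglongrightarrow> measure N {\<omega> \<in> space N. \<forall>i\<in>S. Y' i \<omega> = j i}"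
proof -
  have pinned: "\<forall>j. (\<lambda>n. measure (M n) {\<omega> \<in> space (M n). (\<forall>i\<in>S. j i \<le> Y n i \<omega>) \<and> (\<forall>i\<in>J. Y n i \<omega> = j i)})
      \<longlonglongrightarrow> measure N {\<omega> \<in> space N. (\<forall>i\<in>S. j i \<le> Y' i \<omega>) \<and> (\<forall>i\<in>J. Y' i \<omega> = j i)}"
    if "finite J" "J \<subseteq> S" for J
    using that
  proof (induction J)
    case empty
    then show ?case using tails by simp
  next
    case (insert x J)
    then have x: "x \<in> S" "J \<subseteq> S" "x \<notin> J" by auto
    note IH = insert.IH[OF x(2)]
    have pinM: "measure (M n) {\<omega> \<in> space (M n). (\<forall>i\<in>S. j i \<le> Y n i \<omega>) \<and> (\<forall>i\<in>insert x J. Y n i \<omega> = j i)}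
      = measure (M n) {\<omega> \<in> space (M n). (\<forall>i\<in>S. j i \<le> Y n i \<omega>) \<and> (\<forall>i\<in>J. Y n i \<omega> = j i)}
      - measure (M n) {\<omega> \<in> space (M n). (\<forall>i\<in>S. (j(x := Suc (j x))) i \<le> Y n i \<omega>)
        \<and> (\<forall>i\<in>J. Y n i \<omega> = (j(x := Suc (j x))) i)}" for n j
      by (rule finite_measure.measure_pin_coordinate[OF assms(2)]) (use Y \<open>finite S\<close> x in blast)+
    have pinN: "measure N {\<omega> \<in> space N. (\<forall>i\<in>S. j i \<le> Y' i \<omega>) \<and> (\<forall>i\<in>insert x J. Y' i \<omega> = j i)}
      = measure N {\<omega> \<in> space N. (\<forall>i\<in>S. j i \<le> Y' i \<omega>) \<and> (\<forall>i\<in>J. Y' i \<omega> = j i)}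
      - measure N {\<omega> \<in> space N. (\<forall>i\<in>S. (j(x := Suc (j x))) i \<le> Y' i \<omega>)
        \<and> (\<forall>i\<in>J. Y' i \<omega> = (j(x := Suc (j x))) i)}" for j
      by (rule finite_measure.measure_pin_coordinate[OF assms(3)]) (use Y' \<open>finite S\<close> x in blast)+
    show ?case
    proof
      fix j
      show "(\<lambda>n. measure (M n) {\<omega> \<in> space (M n). (\<forall>i\<in>S. j i \<le> Y n i \<omega>)
            \<and> (\<forall>i\<in>insert x J. Y n i \<omega> = j i)})
        \<longlonglongrightarrow> measure N {\<omega> \<in> space N. (\<forall>i\<in>S. j i \<le> Y' i \<omega>) \<and> (\<forall>i\<in>insert x J. Y' i \<omega> = j i)}"
        using tendsto_diff[OF IH[rule_format, of j] IH[rule_format, of "j(x := Suc (j x))"]]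
        unfolding pinM pinN .
    qed
  qed
  have eq: "{\<omega> \<in> space L. (\<forall>i\<in>S. j i \<le> Z i \<omega>) \<and> (\<forall>i\<in>S. Z i \<omega> = j i)}
      = {\<omega> \<in> space L. \<forall>i\<in>S. Z i \<omega> = j i}" for Z :: "'i \<Rightarrow> 'x \<Rightarrow> nat" and L
    by auto
  show ?thesis using pinned[OF \<open>finite S\<close> order_refl, rule_format, of j] unfolding eq .
qed

section \<open>Arrays of valuations with uniformly small tails\<close>

lemma summable_inverse_squares: "summable (\<lambda>q. 1 / real q ^ 2)"
  using inverse_power_summable[of 2, where ?'a = real] by (simp add: inverse_eq_divide)

lemma primes_atMost_finite: "finite {p::nat. prime p \<and> p \<le> m}"
  by (rule finite_subset[of _ "{..m}"]) auto

text \<open>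
  The common features of the exponents of a random vector and of the limiting geometric exponents.
  Taking \<open>b = 0\<close> in the pair bound also controls single exponents, given a second coordinate; taking
  \<open>a = b = 1\<close> makes it summable over the primes that two coordinates share.
\<close>

locale valuation_array = prob_space M for M :: "'a measure" +
  fixes W :: "'d::finite \<Rightarrow> nat \<Rightarrow> 'a \<Rightarrow> nat" and K :: real
  assumes two_coordinates: "CARD('d) \<ge> 2"
    and W_measurable: "\<And>k p. prime p \<Longrightarrow> W k p \<in> M \<rightarrow>\<^sub>M count_space UNIV"
    and pair_tail: "\<And>i j p a b. i \<noteq> j \<Longrightarrow> prime p \<Longrightarrow>
      prob {\<omega> \<in> space M. a \<le> W i p \<omega> \<and> b \<le> W j p \<omega>} \<le> K / (real p ^ a * real p ^ b)"
begin

lemma ex_other_coordinate: "\<exists>j::'d. j \<noteq> i"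
proof (rule ccontr)
  assume "\<not> (\<exists>j. j \<noteq> i)"
  then have "(UNIV :: 'd set) = {i}" by auto
  then have "CARD('d) = card {i}" by metis
  with two_coordinates show False by simp
qed

lemma single_tail:
  assumes "prime p"
  shows "prob {\<omega> \<in> space M. a \<le> W i p \<omega>} \<le> K / real p ^ a"
proof -
  obtain j where "j \<noteq> i" using ex_other_coordinate by blast
  with pair_tail[of i j p a 0] assms show ?thesis by simp
qed

lemma K_ge_1: "1 \<le> K"
  using single_tail[of 2 0] by (simp add: prob_space)

lemma prime_factor_term_measurable:
  assumes "prime p"
  shows "(\<lambda>\<omega>. prime_factor_term p (\<lambda>k. W k p \<omega>)) \<in> borel_measurable M"
proof -
  have nat_borel: "L \<rightarrow>\<^sub>M count_space UNIV = L \<rightarrow>\<^sub>M (borel :: nat measure)" for L :: "'a measure"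
    by (rule measurable_cong_sets) (simp_all add: sets_borel_eq_count_space)
  have W: "W k p \<in> borel_measurable M" for k
    using W_measurable[OF assms] unfolding nat_borel .
  have [measurable]: "(\<lambda>\<omega>. MAX k. W k p \<omega>) \<in> M \<rightarrow>\<^sub>M count_space UNIV"
    unfolding nat_borel by (intro borel_measurable_Max W) simp
  have [measurable]: "(\<lambda>\<omega>. \<Sum>k\<in>UNIV. W k p \<omega>) \<in> M \<rightarrow>\<^sub>M count_space UNIV"
    unfolding nat_borel by (intro borel_measurable_sum W)
  show ?thesis
    unfolding prime_factor_term_def by measurable
qed

text \<open>
  The factors lie in \<open>(0, 1]\<close>, so the partial products always converge to some \<open>L \<ge> 0\<close>. The infinite
  product is \<open>L\<close> if \<open>L \<noteq> 0\<close>; if \<open>L = 0\<close> it diverges and has its fixed default value. This expresses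
  it through a limit of measurable functions.
\<close>

lemma lcm_limit_measurable: "lcm_limit W \<in> borel_measurable M"
proof -
  define f where "f p \<omega> = (if prime p then prime_factor_term p (\<lambda>k. W k p \<omega>) else 1)" for p \<omega>
  \<comment> \<open>The value of \<^term>\<open>prodinf\<close> on divergent products.\<close>
  define u :: real where "u = (THE z. False)"
  have [measurable]: "f p \<in> borel_measurable M" for p
    using prime_factor_term_measurable[of p] by (cases "prime p") (simp_all add: f_def[abs_def])
  have f: "0 < f p \<omega>" "f p \<omega> \<le> 1" for p \<omega>
    using prime_factor_term_bounds[of p] by (auto simp: f_def)
  have "lcm_limit W \<omega> = (let L = lim (\<lambda>n. \<Prod>p\<le>n. f p \<omega>) in if L \<noteq> 0 then L else u)" for \<omega>
  proof -
    have eq: "lcm_limit W \<omega> = prodinf (\<lambda>p. f p \<omega>)" by (simp add: lcm_limit_eq f_def)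
    have "decseq (\<lambda>n. \<Prod>p\<le>n. f p \<omega>)"
    proof (rule decseq_SucI)
      fix n
      show "(\<Prod>p\<le>Suc n. f p \<omega>) \<le> (\<Prod>p\<le>n. f p \<omega>)"
        using mult_left_le[OF f(2)[of "Suc n" \<omega>], of "\<Prod>p\<le>n. f p \<omega>"] f(1)
        by (simp add: prod_nonneg less_imp_le)
    qed
    moreover have "bdd_below (range (\<lambda>n. \<Prod>p\<le>n. f p \<omega>))"
      using f by (intro bdd_belowI[of _ 0]) (auto intro!: prod_nonneg intro: less_imp_le)
    ultimately have conv: "convergent (\<lambda>n. \<Prod>p\<le>n. f p \<omega>)"
      using LIMSEQ_decseq_INF convergentI by blast
    have nz: "f p \<omega> \<noteq> 0" for p using f(1)[of p \<omega>] by simp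
    show ?thesis
    proof (cases "lim (\<lambda>n. \<Prod>p\<le>n. f p \<omega>) = 0")
      case False
      then show ?thesis 
        using conv eq by (simp add: Let_def prodinf_eq_prod_lim convergent_LIMSEQ_iff)
    next
      case True
      then have "\<not> convergent_prod (\<lambda>p. f p \<omega>)"
        using convergent_prod_iff_convergent[of "\<lambda>p. f p \<omega>"] nz by blast
      then have "\<not> (\<lambda>p. f p \<omega>) has_prod z" for z
        using nz by (auto simp: has_prod_def convergent_prod_def)
      with True eq show ?thesis by (simp add: Let_def prodinf_def u_def)
    qed
  qed
  moreover have "(\<lambda>\<omega>. let L = lim (\<lambda>n. \<Prod>p\<le>n. f p \<omega>) in if L \<noteq> 0 then L else u) \<in> borel_measurable M"
    unfolding Let_def by measurable
  ultimately show ?thesis by (simp cong: measurable_cong)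
qed

text \<open>
  Off this event, the exponents at the primes \<open>p \<le> m\<close> lie in the finite box \<open>{..m}\<close>, and the primes
  above \<open>m\<close> do not contribute to the ratio.
\<close>

definition exceptional :: "nat \<Rightarrow> 'a set" where
  "exceptional m = {\<omega> \<in> space M. (\<exists>k p. prime p \<and> p \<le> m \<and> m < W k p \<omega>) \<or>
     (\<exists>p i j. prime p \<and> m < p \<and> i \<noteq> j \<and> W i p \<omega> \<noteq> 0 \<and> W j p \<omega> \<noteq> 0)}"

text \<open>
  The union bound: there are at most \<open>m\<close> primes up to \<open>m\<close>, each with \<open>p\<^sup>m\<^sup>+\<^sup>1 \<ge> 2\<^sup>m\<^sup>+\<^sup>1\<close>, and at most
  \<open>d\<^sup>2\<close> pairs of coordinates for each prime above \<open>m\<close>. It involves the constant \<open>K\<close> and the dimension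
  only, hence is uniform over all arrays with the same \<open>K\<close>.
\<close>

definition exceptional_bound :: "nat \<Rightarrow> real" where
  "exceptional_bound m = K * real CARD('d) * real m / 2 ^ Suc m
     + K * real CARD('d) ^ 2 * (\<Sum>q. 1 / real (q + Suc m) ^ 2)"

lemma exceptional_bound_tendsto_0: "exceptional_bound \<longlonglongrightarrow> 0"
proof -
  have "(\<lambda>m. real m / 2 ^ Suc m) \<longlonglongrightarrow> 0" by real_asymp
  then have 1: "(\<lambda>m. K * real CARD('d) * (real m / 2 ^ Suc m)) \<longlonglongrightarrow> K * real CARD('d) * 0"
    by (intro tendsto_mult tendsto_const)
  define s where "s = (\<Sum>q. 1 / real q ^ 2)"
  have "(\<lambda>m. \<Sum>q<Suc m. 1 / real q ^ 2) \<longlonglongrightarrow> s"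
    unfolding s_def using LIMSEQ_Suc[OF summable_LIMSEQ[OF summable_inverse_squares]] .
  then have "(\<lambda>m. s - (\<Sum>q<Suc m. 1 / real q ^ 2)) \<longlonglongrightarrow> s - s"
    by (intro tendsto_intros)
  moreover have "(\<Sum>q. 1 / real (q + Suc m) ^ 2) = s - (\<Sum>q<Suc m. 1 / real q ^ 2)" for m
    unfolding s_def by (rule suminf_minus_initial_segment[OF summable_inverse_squares])
  ultimately have 2: "(\<lambda>m. K * real CARD('d) ^ 2 * (\<Sum>q. 1 / real (q + Suc m) ^ 2))
      \<longlonglongrightarrow> K * real CARD('d) ^ 2 * 0"
    by (intro tendsto_mult tendsto_const) simp
  show ?thesis
    using tendsto_add[OF 1 2] unfolding exceptional_bound_def by simp
qed

lemma prob_exceptional_le: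
  "exceptional m \<in> sets M" "prob (exceptional m) \<le> exceptional_bound m"
proof -
  define T where "T = {p::nat. prime p \<and> p \<le> m}"
  have T: "finite T" "card T \<le> m"
  proof -
    show "finite T" unfolding T_def by (rule primes_atMost_finite)
    have "T \<subseteq> {1..m}" unfolding T_def using prime_ge_1_nat by auto
    from card_mono[OF _ this] show "card T \<le> m" by simp
  qed
  define B where "B k p = {\<omega> \<in> space M. Suc m \<le> W k p \<omega>}" for k p
  define big where "big = (\<Union>(k, p)\<in>UNIV \<times> T. B k p)"
  define C where "C p i j = {\<omega> \<in> space M. prime p \<and> i \<noteq> j \<and> 1 \<le> W i p \<omega> \<and> 1 \<le> W j p \<omega>}" for p i j
  \<comment> \<open>The primes above \<open>m\<close> are enumerated as \<open>q + m + 1\<close>, so that \<open>q\<close> ranges over all naturals.\<close>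
  define U where "U q = (\<Union>(i, j)\<in>UNIV. C (q + Suc m) i j)" for q
  have B_sets: "B k p \<in> sets M" if "p \<in> T" for k p
  proof -
    have [measurable]: "W k p \<in> M \<rightarrow>\<^sub>M count_space UNIV"
      using that W_measurable by (simp add: T_def)
    show ?thesis unfolding B_def by measurable
  qed
  have C_sets: "C p i j \<in> sets M" for p i j
  proof (cases "prime p")
    case True
    have [measurable]: "W k p \<in> M \<rightarrow>\<^sub>M count_space UNIV" for k
      using True W_measurable by simp
    show ?thesis unfolding C_def by measurable
  qed (simp add: C_def)
  have U_sets: "U q \<in> sets M" for q
    unfolding U_def using C_sets by (intro sets.finite_UN) auto
  have big_sets: "big \<in> sets M"
    unfolding big_def using B_sets T by (intro sets.finite_UN) auto
  have exc: "exceptional m = big \<union> (\<Union>q. U q)"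
  proof (intro equalityI subsetI)
    fix \<omega> assume "\<omega> \<in> exceptional m"
    then consider k p where "\<omega> \<in> space M" "prime p" "p \<le> m" "m < W k p \<omega>"
      | p i j where "\<omega> \<in> space M" "prime p" "m < p" "i \<noteq> j" "W i p \<omega> \<noteq> 0" "W j p \<omega> \<noteq> 0"
      unfolding exceptional_def by blast
    then show "\<omega> \<in> big \<union> (\<Union>q. U q)"
    proof cases
      case 1
      then show ?thesis by (auto simp: big_def B_def T_def Suc_le_eq)
    next
      case 2
      then have "\<omega> \<in> C ((p - Suc m) + Suc m) i j" by (simp add: C_def Suc_le_eq)
      then show ?thesis unfolding U_def by blast
    qed
  next
    fix \<omega> assume "\<omega> \<in> big \<union> (\<Union>q. U q)"
    then consider k p where "p \<in> T" "\<omega> \<in> B k p" | q i j where "\<omega> \<in> C (q + Suc m) i j"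
      unfolding big_def U_def by blast
    then show "\<omega> \<in> exceptional m"
    proof cases
      case 1
      then show ?thesis by (auto simp: exceptional_def T_def B_def Suc_le_eq)
    next
      case 2
      moreover have "m < q + Suc m" by simp
      ultimately show ?thesis unfolding exceptional_def C_def Suc_le_eq One_nat_def by blast
    qed
  qed
  show "exceptional m \<in> sets M" unfolding exc using big_sets U_sets by auto
  have "prob big \<le> (\<Sum>(k, p)\<in>UNIV \<times> T. prob (B k p))"
    unfolding big_def using T B_sets
    by (intro order.trans[OF finite_measure_subadditive_finite])
       (auto simp: case_prod_unfold)
  also have "\<dots> \<le> (\<Sum>(k, p)\<in>(UNIV::'d set) \<times> T. K / 2 ^ Suc m)"
  proof (intro sum_mono, clarify)
    fix k p assume p: "p \<in> T"
    then have "prob (B k p) \<le> K / real p ^ Suc m"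
      unfolding B_def by (intro single_tail) (simp add: T_def)
    also have "\<dots> \<le> K / 2 ^ Suc m"
    proof (intro divide_left_mono power_mono)
      show "2 \<le> real p" using p prime_ge_2_nat[of p] by (simp add: T_def)
      then show "0 < real p ^ Suc m * 2 ^ Suc m" by simp
    qed (use K_ge_1 in auto)
    finally show "prob (B k p) \<le> K / 2 ^ Suc m" .
  qed
  also have "\<dots> = real CARD('d) * real (card T) * (K / 2 ^ Suc m)"
    by (simp add: case_prod_unfold card_cartesian_product)
  also have "\<dots> \<le> real CARD('d) * real m * (K / 2 ^ Suc m)"
    using T K_ge_1 by (intro mult_right_mono mult_left_mono) auto
  finally have big_le: "prob big \<le> K * real CARD('d) * real m / 2 ^ Suc m"
    by (simp add: mult_ac)
  define c where "c = K * real CARD('d) ^ 2"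
  have U_le: "prob (U q) \<le> c * (1 / real (q + Suc m) ^ 2)" for q
  proof -
    have C_le: "prob (C p i j) \<le> K / real p ^ 2" for p i j
    proof (cases "prime p \<and> i \<noteq> j")
      case True
      then have "prob (C p i j) \<le> K / (real p ^ 1 * real p ^ 1)"
        unfolding C_def using pair_tail[of i j p 1 1] by simp
      then show ?thesis by (simp add: power2_eq_square)
    next
      case False
      then show ?thesis using K_ge_1 by (auto simp: C_def)
    qed
    have "prob (U q) \<le> (\<Sum>(i, j)\<in>UNIV. prob (C (q + Suc m) i j))"
      unfolding U_def using C_sets
      by (intro order.trans[OF finite_measure_subadditive_finite]) (auto simp: case_prod_unfold)
    also have "\<dots> \<le> (\<Sum>(i, j)\<in>(UNIV::('d \<times> 'd) set). K / real (q + Suc m) ^ 2)"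
      using C_le[of "q + Suc m"] by (intro sum_mono) (simp only: case_prod_unfold)
    also have "\<dots> = c * (1 / real (q + Suc m) ^ 2)"
      by (simp add: case_prod_unfold c_def power2_eq_square card_cartesian_product
          flip: UNIV_Times_UNIV)
    finally show ?thesis .
  qed
  have summ: "summable (\<lambda>q. c * (1 / real (q + Suc m) ^ 2))"
    by (intro summable_mult summable_ignore_initial_segment summable_inverse_squares)
  have summU: "summable (\<lambda>q. prob (U q))"
    by (rule summable_comparison_test'[OF summ, of 0]) (use U_le in simp)
  have "prob (\<Union>q. U q) \<le> (\<Sum>q. prob (U q))"
    by (rule finite_measure_subadditive_countably) (use U_sets summU in auto)
  also have "\<dots> \<le> (\<Sum>q. c * (1 / real (q + Suc m) ^ 2))"
    by (intro suminf_le U_le summ summU)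
  also have "\<dots> = c * (\<Sum>q. 1 / real (q + Suc m) ^ 2)"
    by (intro suminf_mult summable_ignore_initial_segment summable_inverse_squares)
  finally have U_all: "prob (\<Union>q. U q) \<le> c * (\<Sum>q. 1 / real (q + Suc m) ^ 2)" .
  have "prob (exceptional m) \<le> prob big + prob (\<Union>q. U q)"
    unfolding exc using big_sets U_sets by (intro measure_Un_le) auto
  with big_le U_all show "prob (exceptional m) \<le> exceptional_bound m"
    unfolding exceptional_bound_def c_def by linarith
qed

text \<open>
  Off the exceptional event, whether the ratio lies in \<open>A\<close> is decided by the finite vector of exponents
  at the primes up to \<open>m\<close>. The set \<open>F\<close> consists of the vectors in the box that put the ratio into \<open>A\<close>.
\<close>

lemma lcm_limit_law_approx:
  fixes A :: "real set" and m :: nat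
  defines "T \<equiv> {p. prime p \<and> p \<le> m}"
  defines "F \<equiv> {w \<in> PiE (UNIV \<times> T) (\<lambda>_. {..m}). (\<Prod>p\<in>T. prime_factor_term p (\<lambda>k. w (k, p))) \<in> A}"
  assumes A: "A \<in> sets borel"
  shows "\<bar>prob {\<omega> \<in> space M. lcm_limit W \<omega> \<in> A}
      - (\<Sum>w\<in>F. prob {\<omega> \<in> space M. \<forall>(k, p)\<in>UNIV \<times> T. W k p \<omega> = w (k, p)})\<bar>
    \<le> exceptional_bound m"
proof -
  define I where "I = (UNIV::'d set) \<times> T"
  define E where "E w = {\<omega> \<in> space M. \<forall>(k, p)\<in>I. W k p \<omega> = w (k, p)}" for w
  define X where "X = {\<omega> \<in> space M. lcm_limit W \<omega> \<in> A}"
  define Y where "Y = (\<Union>w\<in>F. E w)"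
  define v where "v \<omega> = restrict (\<lambda>(k, p). W k p \<omega>) I" for \<omega>
  have fT: "finite T" unfolding T_def by (rule primes_atMost_finite)
  then have fI: "finite I" by (simp add: I_def)
  have fF: "finite F" unfolding F_def using fI by (auto intro!: finite_PiE simp: I_def)
  have F_ext: "w \<in> extensional I" if "w \<in> F" for w
    using that by (auto simp: F_def I_def PiE_def)
  have E_iff: "\<omega> \<in> E w \<longleftrightarrow> \<omega> \<in> space M \<and> w = v \<omega>" if "w \<in> F" for \<omega> w
  proof -
    have "(\<forall>(k, p)\<in>I. W k p \<omega> = w (k, p)) \<longleftrightarrow> w = v \<omega>"
    proof
      assume "\<forall>(k, p)\<in>I. W k p \<omega> = w (k, p)"
      then show "w = v \<omega>"
        by (intro extensionalityI[OF F_ext[OF that]]) (auto simp: v_def)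
    qed (auto simp: v_def)
    then show ?thesis by (simp add: E_def)
  qed
  have E_sets: "E w \<in> sets M" for w
  proof -
    have [measurable]: "(case i of (k, p) \<Rightarrow> W k p) \<in> M \<rightarrow>\<^sub>M count_space UNIV" if "i \<in> I" for i
      using that W_measurable by (auto simp: I_def T_def)
    have "E w = {\<omega> \<in> space M. \<forall>i\<in>I. (case i of (k, p) \<Rightarrow> W k p) \<omega> = w i}"
      unfolding E_def by auto
    also have "\<dots> \<in> sets M" using fI by measurable
    finally show ?thesis .
  qed
  have X_sets: "X \<in> sets M"
    unfolding X_def using measurable_sets[OF lcm_limit_measurable A]
    by (simp add: vimage_def Int_def conj_commute)
  have Y_sets: "Y \<in> sets M" unfolding Y_def using fF E_sets by auto
  have agree: "\<omega> \<in> X \<longleftrightarrow> \<omega> \<in> Y" if "\<omega> \<in> space M" "\<omega> \<notin> exceptional m" for \<omega>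
  proof -
    have small: "W k p \<omega> \<le> m" if "p \<in> T" for k p
    proof (rule ccontr)
      assume "\<not> W k p \<omega> \<le> m"
      then have "prime p \<and> p \<le> m \<and> m < W k p \<omega>" using that by (simp add: T_def)
      with \<open>\<omega> \<in> space M\<close> \<open>\<omega> \<notin> exceptional m\<close> show False
        unfolding exceptional_def by blast
    qed
    have no_collision: "W i p \<omega> = 0 \<or> W j p \<omega> = 0" if "prime p" "p \<notin> T" "i \<noteq> j" for p i j
    proof (rule ccontr)
      assume "\<not> (W i p \<omega> = 0 \<or> W j p \<omega> = 0)"
      then have "prime p \<and> m < p \<and> i \<noteq> j \<and> W i p \<omega> \<noteq> 0 \<and> W j p \<omega> \<noteq> 0"
        using that by (simp add: T_def)
      with \<open>\<omega> \<in> space M\<close> \<open>\<omega> \<notin> exceptional m\<close> show False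
        unfolding exceptional_def by blast
    qed
    have box: "v \<omega> \<in> PiE (UNIV \<times> T) (\<lambda>_. {..m})"
      unfolding v_def I_def using small by (auto intro!: restrict_PiE_iff [THEN iffD2])
    have "lcm_limit W \<omega> = (\<Prod>p\<in>T. prime_factor_term p (\<lambda>k. W k p \<omega>))"
    proof (rule lcm_limit_eq_finite_prod)
      show "W i p \<omega> = 0 \<or> W j p \<omega> = 0" if "prime p" "p \<notin> T" "i \<noteq> j" for p i j
        using that by (rule no_collision)
    qed (use fT in \<open>simp_all add: T_def\<close>)
    also have "\<dots> = (\<Prod>p\<in>T. prime_factor_term p (\<lambda>k. v \<omega> (k, p)))"
      by (intro prod.cong refl) (simp add: v_def I_def)
    finally have "\<omega> \<in> X \<longleftrightarrow> v \<omega> \<in> F"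
      using box that by (simp add: X_def F_def)
    also have "\<dots> \<longleftrightarrow> \<omega> \<in> Y"
      using that E_iff by (auto simp: Y_def)
    finally show ?thesis .
  qed
  have sub: "X \<subseteq> Y \<union> exceptional m" "Y \<subseteq> X \<union> exceptional m"
    using agree sets.sets_into_space[OF X_sets] sets.sets_into_space[OF Y_sets] by blast+
  have exc: "exceptional m \<in> sets M" by (rule prob_exceptional_le)
  have "prob X \<le> prob (Y \<union> exceptional m)"
    using sub Y_sets exc by (intro finite_measure_mono) auto
  also have "\<dots> \<le> prob Y + prob (exceptional m)"
    using Y_sets exc by (rule measure_Un_le)
  finally have 1: "prob X \<le> prob Y + prob (exceptional m)" .
  have "prob Y \<le> prob (X \<union> exceptional m)"
    using sub X_sets exc by (intro finite_measure_mono) auto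
  also have "\<dots> \<le> prob X + prob (exceptional m)"
    using X_sets exc by (rule measure_Un_le)
  finally have 2: "prob Y \<le> prob X + prob (exceptional m)" .
  have "prob Y = (\<Sum>w\<in>F. prob (E w))"
    unfolding Y_def using fF E_sets E_iff
    by (intro finite_measure_finite_Union) (auto simp: disjoint_family_on_def)
  with 1 2 prob_exceptional_le(2)[of m] show ?thesis
    unfolding X_def E_def I_def by linarith
qed

end

section \<open>Convergence of the laws of the ratio\<close>

text \<open>
  Interchange of limits: the approximations \<open>y m\<close> are uniform in \<open>n\<close>.
\<close>

lemma tendsto_of_uniform_approx:
  fixes x :: "nat \<Rightarrow> real"
  assumes "e \<longlonglongrightarrow> 0"
    and "\<And>m n. \<bar>x n - y m n\<bar> \<le> e m" "\<And>m. \<bar>l - z m\<bar> \<le> e m"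
    and "\<And>m. y m \<longlonglongrightarrow> z m"
  shows "x \<longlonglongrightarrow> l"
proof (rule tendstoI)
  fix r :: real assume "r > 0"
  with assms(1) have "\<forall>\<^sub>F m in sequentially. dist (e m) 0 < r / 3"
    by (intro tendstoD) auto
  then obtain m where m: "dist (e m) 0 < r / 3"
    by (auto simp: eventually_sequentially)
  have "\<forall>\<^sub>F n in sequentially. dist (y m n) (z m) < r / 3"
    using assms(4) \<open>r > 0\<close> by (intro tendstoD) auto
  then show "\<forall>\<^sub>F n in sequentially. dist (x n) l < r"
  proof eventually_elim
    case (elim n)
    then show ?case
      using m assms(2)[of n m] assms(3)[of m] unfolding dist_real_def by linarith
  qed
qed

text \<open>
  For fixed \<open>m\<close>, the approximations are finite sums of point probabilities,
  and these converge.
\<close>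

theorem lcm_limit_laws_converge:
  fixes W :: "nat \<Rightarrow> 'd::finite \<Rightarrow> nat \<Rightarrow> 'a \<Rightarrow> nat" and G :: "'d \<Rightarrow> nat \<Rightarrow> 'b \<Rightarrow> nat"
  assumes W: "\<And>n. valuation_array (M n) (W n) K" and G: "valuation_array N G K"
    and tails: "\<And>T j. finite T \<Longrightarrow> (\<And>p. p \<in> T \<Longrightarrow> prime p) \<Longrightarrow>
      (\<lambda>n. measure (M n) {\<omega> \<in> space (M n). \<forall>k. \<forall>p\<in>T. j k p \<le> W n k p \<omega>})
        \<longlonglongrightarrow> measure N {\<omega> \<in> space N. \<forall>k. \<forall>p\<in>T. j k p \<le> G k p \<omega>}"
    and A: "A \<in> sets borel"
  shows "(\<lambda>n. measure (M n) {\<omega> \<in> space (M n). lcm_limit (W n) \<omega> \<in> A})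
    \<longlonglongrightarrow> measure N {\<omega> \<in> space N. lcm_limit G \<omega> \<in> A}"
proof -
  interpret W: valuation_array "M n" "W n" K for n by (rule W)
  interpret G: valuation_array N G K by (rule G)
  define T where "T m = {p::nat. prime p \<and> p \<le> m}" for m
  define F where "F m = {w \<in> PiE ((UNIV::'d set) \<times> T m) (\<lambda>_. {..m}).
    (\<Prod>p\<in>T m. prime_factor_term p (\<lambda>k. w (k, p))) \<in> A}" for m
  show ?thesis
  proof (rule tendsto_of_uniform_approx[OF G.exceptional_bound_tendsto_0])
    fix m n
    show "\<bar>W.prob n {\<omega> \<in> space (M n). lcm_limit (W n) \<omega> \<in> A}
        - (\<Sum>w\<in>F m. W.prob n {\<omega> \<in> space (M n). \<forall>(k, p)\<in>UNIV \<times> T m. W n k p \<omega> = w (k, p)})\<bar>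
      \<le> G.exceptional_bound m"
      using W.lcm_limit_law_approx[OF A, of n m] unfolding F_def T_def .
    show "\<bar>G.prob {\<omega> \<in> space N. lcm_limit G \<omega> \<in> A}
        - (\<Sum>w\<in>F m. G.prob {\<omega> \<in> space N. \<forall>(k, p)\<in>UNIV \<times> T m. G k p \<omega> = w (k, p)})\<bar>
      \<le> G.exceptional_bound m"
      using G.lcm_limit_law_approx[OF A, of m] unfolding F_def T_def .
    show "(\<lambda>n. \<Sum>w\<in>F m. W.prob n {\<omega> \<in> space (M n). \<forall>(k, p)\<in>UNIV \<times> T m. W n k p \<omega> = w (k, p)})
      \<longlonglongrightarrow> (\<Sum>w\<in>F m. G.prob {\<omega> \<in> space N. \<forall>(k, p)\<in>UNIV \<times> T m. G k p \<omega> = w (k, p)})"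
    proof (rule tendsto_sum)
      fix w
      have fT: "finite (T m)" unfolding T_def by (rule primes_atMost_finite)
      have prime_T: "prime p" if "p \<in> T m" for p using that by (simp add: T_def)
      have "(\<lambda>n. measure (M n) {\<omega> \<in> space (M n). \<forall>i\<in>UNIV \<times> T m. (case i of (k, p) \<Rightarrow> W n k p) \<omega> = w i})
        \<longlonglongrightarrow> measure N {\<omega> \<in> space N. \<forall>i\<in>UNIV \<times> T m. (case i of (k, p) \<Rightarrow> G k p) \<omega> = w i}"
      proof (rule point_probabilities_from_tails)
        fix j :: "'d \<times> nat \<Rightarrow> nat"
        show "(\<lambda>n. measure (M n) {\<omega> \<in> space (M n). \<forall>i\<in>UNIV \<times> T m. j i \<le> (case i of (k, p) \<Rightarrow> W n k p) \<omega>})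
          \<longlonglongrightarrow> measure N {\<omega> \<in> space N. \<forall>i\<in>UNIV \<times> T m. j i \<le> (case i of (k, p) \<Rightarrow> G k p) \<omega>}"
          using tails[OF fT prime_T, of "\<lambda>k p. j (k, p)"] by simp
      qed (use fT prime_T W.W_measurable G.W_measurable W.finite_measure_axioms
             G.finite_measure_axioms in auto)
      then show "(\<lambda>n. W.prob n {\<omega> \<in> space (M n). \<forall>(k, p)\<in>UNIV \<times> T m. W n k p \<omega> = w (k, p)})
        \<longlonglongrightarrow> G.prob {\<omega> \<in> space N. \<forall>(k, p)\<in>UNIV \<times> T m. G k p \<omega> = w (k, p)}"
        by (simp add: case_prod_unfold)
    qed
  qed
qed

section \<open>Valuations of a uniformly distributed vector\<close>

text \<open>
  On positive vectors, joint tail events of the valuations coincide with lattices, to which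
  equidistribution applies.
\<close>

lemma valuation_tail_eq_divisibility:
  fixes D :: "(int ^ 'd::finite) set"
  assumes "D \<subseteq> pos_vecs" "finite T" "\<And>p. p \<in> T \<Longrightarrow> prime p"
  shows "D \<inter> {x. \<forall>k. \<forall>p\<in>T. j k p \<le> coord_valuation k p x}
    = D \<inter> {x. \<forall>k. int (\<Prod>p\<in>T. p ^ j k p) dvd x $ k}"
proof -
  have "(\<forall>p\<in>T. j k p \<le> coord_valuation k p x) \<longleftrightarrow> int (\<Prod>p\<in>T. p ^ j k p) dvd x $ k"
    if "x \<in> D" for x k
  proof -
    have x: "x $ k \<ge> 1" using that assms(1) by (auto simp: pos_vecs_def)
    have "int (\<Prod>p\<in>T. p ^ j k p) dvd x $ k \<longleftrightarrow> int (\<Prod>p\<in>T. p ^ j k p) dvd int (nat (x $ k))"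
      using x by simp
    also have "\<dots> \<longleftrightarrow> (\<Prod>p\<in>T. p ^ j k p) dvd nat (x $ k)"
      by (rule of_nat_dvd_iff)
    also have "\<dots> \<longleftrightarrow> (\<forall>p\<in>T. j k p \<le> multiplicity p (nat (x $ k)))"
      using assms x by (intro prod_prime_powers_dvd_iff) auto
    finally show ?thesis by (simp add: coord_valuation_def)
  qed
  then show ?thesis by blast
qed

lemma valuation_array_pmf_of_set:
  fixes D :: "(int ^ 'd::finite) set"
  assumes "CARD('d) \<ge> 2" "finite D" "D \<noteq> {}" "D \<subseteq> pos_vecs"
    and K: "\<And>i j a b. i \<noteq> j \<Longrightarrow> a \<ge> 1 \<Longrightarrow> b \<ge> 1 \<Longrightarrow>
      real (card (D \<inter> coord_multiples i a \<inter> coord_multiples j b)) / real (card D)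
        \<le> K / (real a * real b)"
  shows "valuation_array (measure_pmf (pmf_of_set D)) coord_valuation K"
proof unfold_locales
  fix i j :: 'd and p a b :: nat
  assume ij: "i \<noteq> j" and p: "prime p"
  have dvd: "c \<le> coord_valuation k p x \<longleftrightarrow> int (p ^ c) dvd x $ k" if "x \<in> D" for c k x
  proof -
    have x: "x $ k \<ge> 1" using that assms by (auto simp: pos_vecs_def)
    have "c \<le> coord_valuation k p x \<longleftrightarrow> p ^ c dvd nat (x $ k)"
      unfolding coord_valuation_def using x p
      by (intro power_dvd_iff_le_multiplicity [symmetric]) (auto dest: not_prime_unit)
    also have "\<dots> \<longleftrightarrow> int (p ^ c) dvd int (nat (x $ k))" by (rule of_nat_dvd_iff [symmetric])
    finally show ?thesis using x by simp
  qed
  have "D \<inter> {x. a \<le> coord_valuation i p x \<and> b \<le> coord_valuation j p x}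
      = D \<inter> coord_multiples i (p ^ a) \<inter> coord_multiples j (p ^ b)"
    unfolding coord_multiples_def using dvd by blast
  moreover have "p ^ a \<ge> 1" "p ^ b \<ge> 1" using p by (auto simp: prime_gt_0_nat Suc_leI)
  ultimately show "measure_pmf.prob (pmf_of_set D) {x \<in> space (measure_pmf (pmf_of_set D)).
      a \<le> coord_valuation i p x \<and> b \<le> coord_valuation j p x} \<le> K / (real p ^ a * real p ^ b)"
    using K[OF ij, of "p ^ a" "p ^ b"] assms by (simp add: measure_pmf_of_set)
qed (use assms in auto)

section \<open>Independent geometric exponents\<close>

text \<open>
  For \<open>I\<close> the product of all coordinates with a finite set of primes, the right-hand side is
  \<open>1 / \<Prod> a\<^sub>k\<close> with \<open>a\<^sub>k = \<Prod>\<^sub>p p ^ j (k, p)\<close>, the limit density of the lattice \<open>a\<^sub>k | x\<^sub>k\<close>.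
\<close>

lemma (in prob_space) geometric_joint_tail:
  fixes G :: "'d::finite \<Rightarrow> nat \<Rightarrow> 'a \<Rightarrow> nat"
  assumes indep: "indep_vars (\<lambda>_. count_space UNIV) (\<lambda>(k, p). G k p) (UNIV \<times> {p. prime p})"
    and geom: "\<And>k p j. prime p \<Longrightarrow>
      prob {\<omega> \<in> space M. G k p \<omega> \<ge> j} = real p powi (- int j)"
    and I: "finite I" "I \<subseteq> UNIV \<times> {p. prime p}"
  shows "prob {\<omega> \<in> space M. \<forall>(k, p)\<in>I. j (k, p) \<le> G k p \<omega>} = (\<Prod>(k, p)\<in>I. 1 / real p ^ j (k, p))"
proof (cases "I = {}")
  case False
  have "prob (\<Inter>i\<in>I. (case i of (k, p) \<Rightarrow> G k p) -` {j i..} \<inter> space M)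
      = (\<Prod>i\<in>I. prob ((case i of (k, p) \<Rightarrow> G k p) -` {j i..} \<inter> space M))"
    by (rule indep_varsD[OF indep False I(1) I(2)]) simp
  also have "(\<Inter>i\<in>I. (case i of (k, p) \<Rightarrow> G k p) -` {j i..} \<inter> space M)
      = {\<omega> \<in> space M. \<forall>(k, p)\<in>I. j (k, p) \<le> G k p \<omega>}"
    using False by auto
  also have "(\<Prod>i\<in>I. prob ((case i of (k, p) \<Rightarrow> G k p) -` {j i..} \<inter> space M))
      = (\<Prod>(k, p)\<in>I. 1 / real p ^ j (k, p))"
  proof (intro prod.cong refl, clarify)
    fix k p assume "(k, p) \<in> I"
    then have p: "prime p" using I by auto
    have "G k p -` {j (k, p)..} \<inter> space M = {\<omega> \<in> space M. G k p \<omega> \<ge> j (k, p)}" by auto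
    then show "prob (G k p -` {j (k, p)..} \<inter> space M) = 1 / real p ^ j (k, p)"
      using geom[OF p] by (simp add: power_int_minus inverse_eq_divide)
  qed
  finally show ?thesis .
qed (simp add: prob_space)

lemma (in prob_space) valuation_array_geometric:
  fixes G :: "'d::finite \<Rightarrow> nat \<Rightarrow> 'a \<Rightarrow> nat"
  assumes "CARD('d) \<ge> 2"
    and indep: "indep_vars (\<lambda>_. count_space UNIV) (\<lambda>(k, p). G k p) (UNIV \<times> {p. prime p})"
    and geom: "\<And>k p j. prime p \<Longrightarrow>
      prob {\<omega> \<in> space M. G k p \<omega> \<ge> j} = real p powi (- int j)"
    and "1 \<le> K"
  shows "valuation_array M G K"
proof unfold_locales
  fix k p assume "prime (p::nat)"
  then show "G k p \<in> M \<rightarrow>\<^sub>M count_space UNIV"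
    using indep by (auto simp: indep_vars_def2)
next
  fix i j :: 'd and p a b :: nat
  assume ij: "i \<noteq> j" and p: "prime p"
  define e where "e x = (if x = (i, p) then a else b)" for x
  have "prob {\<omega> \<in> space M. \<forall>(k, q)\<in>{(i, p), (j, p)}. e (k, q) \<le> G k q \<omega>}
      = (\<Prod>(k, q)\<in>{(i, p), (j, p)}. 1 / real q ^ e (k, q))"
    using p by (intro geometric_joint_tail indep geom) auto
  then have "prob {\<omega> \<in> space M. a \<le> G i p \<omega> \<and> b \<le> G j p \<omega>} = 1 / (real p ^ a * real p ^ b)"
    using ij by (simp add: e_def)
  also have "\<dots> \<le> K / (real p ^ a * real p ^ b)"
    using \<open>1 \<le> K\<close> by (intro divide_right_mono) auto
  finally show "prob {\<omega> \<in> space M. a \<le> G i p \<omega> \<and> b \<le> G j p \<omega>} \<le> K / (real p ^ a * real p ^ b)" .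
qed (use assms in auto)

section \<open>Convergence in distribution\<close>

theorem corollary2p6:
  fixes D :: "nat \<Rightarrow> (int ^ 'd::finite) set"
    and M :: "nat \<Rightarrow> 'a measure" and X :: "nat \<Rightarrow> 'a \<Rightarrow> int ^ 'd"
    and P :: "'b measure" and G :: "'d \<Rightarrow> nat \<Rightarrow> 'b \<Rightarrow> nat"
  assumes "CARD('d) \<ge> 2"
    and "\<And>n. n \<ge> 1 \<Longrightarrow> finite (D n) \<and> D n \<noteq> {} \<and> D n \<subseteq> pos_vecs"
    and "\<And>c :: int ^ 'd.
      (\<lambda>n. real (card ((\<lambda>x. x + c) ` D n \<inter> D n)) / real (card (D n))) \<longlonglongrightarrow> 1"
    and "\<exists>K>0. \<forall>i j. i \<noteq> j \<longrightarrow> (\<forall>a\<ge>1. \<forall>b\<ge>1. \<forall>n\<ge>1.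
      real (card (D n \<inter> coord_multiples i a \<inter> coord_multiples j b)) / real (card (D n))
        \<le> K / (real a * real b))"
    and "\<And>n. n \<ge> 1 \<Longrightarrow> prob_space (M n)"
    and "\<And>n. n \<ge> 1 \<Longrightarrow> X n \<in> measurable (M n) (count_space UNIV)"
    and "\<And>n. n \<ge> 1 \<Longrightarrow>
      distr (M n) (count_space UNIV) (X n) = measure_pmf (pmf_of_set (D n))"
    and "prob_space P"
    and "prob_space.indep_vars P (\<lambda>_. count_space UNIV) (\<lambda>(k, p). G k p)
      (UNIV \<times> {p. prime p})"
    and "\<And>k p j. prime p \<Longrightarrow>
      measure P {\<omega> \<in> space P. G k p \<omega> \<ge> j} = real p powi (- int j)"
  shows "weak_conv_m (\<lambda>n. distr (M n) borel (\<lambda>\<omega>. lcm_prod_ratio (X n \<omega>)))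
    (distr P borel (lcm_limit G))"
proof -
  interpret P: prob_space P by fact
  \<comment> \<open>The hypotheses speak of the indices \<open>n \<ge> 1\<close>, so the sequence is shifted by one.\<close>
  define E where "E n = D (Suc n)" for n
  have E: "finite (E n)" "E n \<noteq> {}" "E n \<subseteq> pos_vecs" for n
    using assms(2)[of "Suc n"] by (auto simp: E_def)
  have shift: "(\<lambda>n. real (card ((\<lambda>x. x + c) ` E n \<inter> E n)) / real (card (E n))) \<longlonglongrightarrow> 1"
    for c :: "int ^ 'd"
    unfolding E_def using assms(3)[of c] by (rule LIMSEQ_Suc)
  obtain K where K: "\<And>i j a b n. i \<noteq> j \<Longrightarrow> a \<ge> 1 \<Longrightarrow> b \<ge> 1 \<Longrightarrow>
      real (card (E n \<inter> coord_multiples i a \<inter> coord_multiples j b)) / real (card (E n))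
        \<le> K / (real a * real b)"
    using assms(4) unfolding E_def by (metis le_add1 plus_1_eq_Suc)
  have W: "valuation_array (measure_pmf (pmf_of_set (E n))) coord_valuation K" for n
    by (rule valuation_array_pmf_of_set) (use assms(1) E K in auto)
  have G: "valuation_array P G K"
    using valuation_array.K_ge_1[OF W]
    by (intro P.valuation_array_geometric assms)
  have tails: "(\<lambda>n. measure_pmf.prob (pmf_of_set (E n))
        {x \<in> space (measure_pmf (pmf_of_set (E n))). \<forall>k. \<forall>p\<in>T. j k p \<le> coord_valuation k p x})
      \<longlonglongrightarrow> P.prob {\<omega> \<in> space P. \<forall>k. \<forall>p\<in>T. j k p \<le> G k p \<omega>}"
    if T: "finite T" "\<And>p. p \<in> T \<Longrightarrow> prime p" for T and j :: "'d \<Rightarrow> nat \<Rightarrow> nat"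
  proof -
    define a where "a k = (\<Prod>p\<in>T. p ^ j k p)" for k
    have a: "a k > 0" for k
      unfolding a_def using T by (intro prod_pos) (auto simp: prime_gt_0_nat)
    have "measure_pmf.prob (pmf_of_set (E n))
        {x \<in> space (measure_pmf (pmf_of_set (E n))). \<forall>k. \<forall>p\<in>T. j k p \<le> coord_valuation k p x}
      = real (card (E n \<inter> {x. \<forall>k. int (a k) dvd x $ k})) / real (card (E n))" for n
      using E[of n] valuation_tail_eq_divisibility[OF E(3)[of n] T, of j]
      by (simp add: measure_pmf_of_set a_def del: of_nat_prod)
    moreover have "P.prob {\<omega> \<in> space P. \<forall>k. \<forall>p\<in>T. j k p \<le> G k p \<omega>} = 1 / (\<Prod>k\<in>UNIV. real (a k))"
    proof -
      have "P.prob {\<omega> \<in> space P. \<forall>(k, p)\<in>UNIV \<times> T. (\<lambda>(k, p). j k p) (k, p) \<le> G k p \<omega>}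
          = (\<Prod>(k, p)\<in>UNIV \<times> T. 1 / real p ^ (\<lambda>(k, p). j k p) (k, p))"
        using T by (intro P.geometric_joint_tail assms) auto
      then show ?thesis
        by (simp add: a_def prod.cartesian_product [symmetric] prod_dividef)
    qed
    ultimately show ?thesis
      using residue_equidistribution[OF E(1,2) shift a] by simp
  qed
  have cdf_ratio: "cdf (distr (M (Suc n)) borel (\<lambda>\<omega>. lcm_prod_ratio (X (Suc n) \<omega>))) t
      = measure_pmf.prob (pmf_of_set (E n))
          {x \<in> space (measure_pmf (pmf_of_set (E n))). lcm_limit coord_valuation x \<in> {..t}}" for n t
  proof -
    have [measurable]: "X (Suc n) \<in> M (Suc n) \<rightarrow>\<^sub>M count_space UNIV"
      by (rule assms) simp
    have "cdf (distr (M (Suc n)) borel (\<lambda>\<omega>. lcm_prod_ratio (X (Suc n) \<omega>))) t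
        = measure (distr (M (Suc n)) (count_space UNIV) (X (Suc n))) {x. lcm_prod_ratio x \<le> t}"
      unfolding cdf_def
      by (subst measure_distr, measurable, simp, subst measure_distr, measurable)
         (auto intro!: arg_cong[of _ _ "measure _"])
    also have "\<dots> = measure_pmf.prob (pmf_of_set (E n)) {x. lcm_prod_ratio x \<le> t}"
      by (simp add: assms(7) E_def)
    also have "\<dots> = measure_pmf.prob (pmf_of_set (E n)) {x. lcm_limit coord_valuation x \<le> t}"
    proof -
      have "lcm_prod_ratio x = lcm_limit coord_valuation x" if "x \<in> E n" for x
        using that E(3)[of n] by (intro lcm_prod_ratio_eq_lcm_limit) auto
      then show ?thesis
        using E[of n] by (intro measure_pmf.finite_measure_eq_AE AE_pmfI) auto
    qed
    finally show ?thesis by simp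
  qed
  have cdf_limit: "cdf (distr P borel (lcm_limit G)) t = P.prob {\<omega> \<in> space P. lcm_limit G \<omega> \<in> {..t}}" for t
    unfolding cdf_def using valuation_array.lcm_limit_measurable[OF G]
    by (subst measure_distr) (auto intro!: arg_cong[of _ _ "measure _"])
  have "(\<lambda>n. cdf (distr (M (Suc n)) borel (\<lambda>\<omega>. lcm_prod_ratio (X (Suc n) \<omega>))) t)
      \<longlonglongrightarrow> cdf (distr P borel (lcm_limit G)) t" for t
    unfolding cdf_ratio cdf_limit by (rule lcm_limit_laws_converge[OF W G tails]) auto
  then show ?thesis
    unfolding weak_conv_m_def weak_conv_def by (auto intro: LIMSEQ_imp_Suc)
qed

end
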